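(* There is an equivalence of categories between the category $\mathcal{A}$ of preordered actions and the category $\mathcal{S}$ of Schreier split extensions in $\mathbf{RNMono}(\mathbf{Mon})$.
   Context: Monoids are written additively but are not assumed commutative. A submonoid $P$ of a monoid $M$ is right normal if $a+P\subseteq P+a$ for every $a\in M$. $\mathbf{RNMono}(\mathbf{Mon})$ is the category whose objects are pairs $(M,P_M)$ with $M$ a monoid and $P_M$ a right normal submonoid of $M$ (the inclusion $P_M\to M$), and whose morphisms $(M,P_M)\to(M',P_{M'})$ are monoid homomorphisms $f\colon M\to M'$ with $f(P_M)\subseteq P_{M'}$; the restriction is written $\bar f\colon P_M\to P_{M'}$. Schreier split epimorphism of monoids: monoid homomorphisms $k\colon X\to A$, $p\colon A\to B$, $s\colon B\to A$ with $ps=1_B$ and $k$ the kernel of $p$, together with a set-theoretical map $q\colon A\to X$ such that (S1) $kq(a)+sp(a)=a$ for all $a\in A$; (S2) $q(k(x)+s(b))=x$ for all $x\in X$, $b\in B$. Category $\mathcal{S}$: an object (a Schreier split extension, also called Schreier split epimorphism, in $\mathbf{RNMono}(\mathbf{Mon})$) is a Schreier split epimorphism of monoids $(k\colon X\to A,\ p\colon A\to B,\ s\colon B\to A,\ q)$ together with right normal submonoids $P_X\subseteq X$, $P_A\subseteq A$, $P_B\subseteq B$ such that $k(P_X)\subseteq P_A$, $p(P_A)\subseteq P_B$, $s(P_B)\subseteq P_A$ (no condition relating $q$ to these submonoids is imposed). A morphism from such an object to another one $(X',A',B',k',p',s',q',P_{X'},P_{A'},P_{B'})$ is a triple $(f_0,f_1,f_2)$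 of monoid homomorphisms $f_0\colon X\to X'$, $f_1\colon A\to A'$, $f_2\colon B\to B'$ with $f_0(P_X)\subseteq P_{X'}$, $f_1(P_A)\subseteq P_{A'}$, $f_2(P_B)\subseteq P_{B'}$, making the evident diagram commute: $f_1k=k'f_0$, $p'f_1=f_2p$, $f_1s=s'f_2$ (and $q'f_1=f_0q$, which then holds automatically). Category $\mathcal{A}$: an object (a preordered action of $(B,P_B)$ on $(X,P_X)$), denoted $(X,B,P_X,P_B,\varphi,\xi)$, consists of objects $(X,P_X)$, $(B,P_B)$ of $\mathbf{RNMono}(\mathbf{Mon})$, a monoid homomorphism $\varphi\colon B\to\mathrm{End}(X)$ into the monoid of endomorphisms of the monoid $X$ (write $b\cdot x=\varphi(b)(x)$), and a set-theoretical map $\xi\colon X\times P_B\to X$ such that: (A1) $\xi(0,b)=0$ for all $b\in P_B$; (A2) if $x\in P_X$ then $\xi(x,0)=x$; (A3) for $x,x'\in X$ and $b,b'\in P_B$, if $\xi(x,b)=x$ and $\xi(x',b')=x'$ then $\xi(x+b\cdot x',b+b')=x+b\cdot x'$; (A4) for all $x,u\in X$, $v\in P_B$, $b\in B$, if $\xi(u,v)=u$ then there exist $u'\in X$ and $v'\in P_B$ such that $b+v=v'+b$, $x+b\cdot u=u'+v'\cdot x$ and $\xi(u',v')=u'$. A morphism $(X,B,P_X,P_B,\varphi,\xi)\to(X',B',P_{X'},P_{B'},\varphi',\xi')$ is a pair $(f_0,f_2)$ of monoid homomorphisms $f_0\colon X\to X'$, $f_2\colon B\to B'$ with $f_0(P_X)\subseteq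 P_{X'}$ and $f_2(P_B)\subseteq P_{B'}$, such that $f_0(b\cdot x)=f_2(b)\cdot f_0(x)$ for all $b\in B$, $x\in X$, and $\xi'(f_0(u),f_2(v))=f_0(u)$ whenever $(u,v)\in X\times P_B$ satisfies $\xi(u,v)=u$. Composition in $\mathcal{S}$ and $\mathcal{A}$ is componentwise. *)

theory Defs
  imports "HOL-Algebra.Coset" "HOL-Library.FuncSet"
begin

section \<open>Categories and equivalences of categories\<close>

text \<open>
  A category is given by a set of objects, hom-sets indexed by pairs of objects, identities and
  composition.  Hom-sets for different pairs of objects need not be disjoint, so composition is
  indexed by the three objects involved: for \<open>f : a \<rightarrow> b\<close> and \<open>g : b \<rightarrow> c\<close> the composite
  "g after f" is \<open>Cmp C a b c g f\<close>.  For the same reason the arrow part of a functor is indexed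
  by the domain and codomain of its argument.
\<close>

record ('o, 'm) category_data =
  Obj :: "'o set"
  Hom :: "'o \<Rightarrow> 'o \<Rightarrow> 'm set"
  Idn :: "'o \<Rightarrow> 'm"
  Cmp :: "'o \<Rightarrow> 'o \<Rightarrow> 'o \<Rightarrow> 'm \<Rightarrow> 'm \<Rightarrow> 'm"

locale category =
  fixes C :: "('o, 'm) category_data"
  assumes Idn_in_Hom: "a \<in> Obj C \<Longrightarrow> Idn C a \<in> Hom C a a"
    and Cmp_in_Hom:
      "\<lbrakk>a \<in> Obj C; b \<in> Obj C; c \<in> Obj C; f \<in> Hom C a b; g \<in> Hom C b c\<rbrakk>
        \<Longrightarrow> Cmp C a b c g f \<in> Hom C a c"
    and Cmp_Idn_right:
      "\<lbrakk>a \<in> Obj C; b \<in> Obj C; f \<in> Hom C a b\<rbrakk> \<Longrightarrow> Cmp C a a b f (Idn C a) = f"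
    and Cmp_Idn_left:
      "\<lbrakk>a \<in> Obj C; b \<in> Obj C; f \<in> Hom C a b\<rbrakk> \<Longrightarrow> Cmp C a b b (Idn C b) f = f"
    and Cmp_assoc:
      "\<lbrakk>a \<in> Obj C; b \<in> Obj C; c \<in> Obj C; d \<in> Obj C;
        f \<in> Hom C a b; g \<in> Hom C b c; h \<in> Hom C c d\<rbrakk>
        \<Longrightarrow> Cmp C a b d (Cmp C b c d h g) f = Cmp C a c d h (Cmp C a b c g f)"

definition is_iso :: "('o, 'm) category_data \<Rightarrow> 'o \<Rightarrow> 'o \<Rightarrow> 'm \<Rightarrow> bool" where
  "is_iso C a b f \<longleftrightarrow>
     f \<in> Hom C a b \<and>
     (\<exists>g \<in> Hom C b a. Cmp C a b a g f = Idn C a \<and> Cmp C b a b f g = Idn C b)"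

record ('o, 'm, 'p, 'n) functor_data =
  on_Obj :: "'o \<Rightarrow> 'p"
  on_Hom :: "'o \<Rightarrow> 'o \<Rightarrow> 'm \<Rightarrow> 'n"

locale cat_functor = source: category C + target: category D
  for C :: "('o, 'm) category_data" and D :: "('p, 'n) category_data" +
  fixes F :: "('o, 'm, 'p, 'n) functor_data"
  assumes on_Obj_in: "a \<in> Obj C \<Longrightarrow> on_Obj F a \<in> Obj D"
    and on_Hom_in:
      "\<lbrakk>a \<in> Obj C; b \<in> Obj C; f \<in> Hom C a b\<rbrakk>
        \<Longrightarrow> on_Hom F a b f \<in> Hom D (on_Obj F a) (on_Obj F b)"
    and on_Hom_Idn: "a \<in> Obj C \<Longrightarrow> on_Hom F a a (Idn C a) = Idn D (on_Obj F a)"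
    and on_Hom_Cmp:
      "\<lbrakk>a \<in> Obj C; b \<in> Obj C; c \<in> Obj C; f \<in> Hom C a b; g \<in> Hom C b c\<rbrakk>
        \<Longrightarrow> on_Hom F a c (Cmp C a b c g f) =
            Cmp D (on_Obj F a) (on_Obj F b) (on_Obj F c) (on_Hom F b c g) (on_Hom F a b f)"

definition id_functor :: "('o, 'm, 'o, 'm) functor_data" where
  "id_functor = \<lparr>on_Obj = (\<lambda>a. a), on_Hom = (\<lambda>a b f. f)\<rparr>"

definition comp_functor ::
  "('p, 'n, 'q, 'l) functor_data \<Rightarrow> ('o, 'm, 'p, 'n) functor_data \<Rightarrow> ('o, 'm, 'q, 'l) functor_data"
  where
  "comp_functor G F =
     \<lparr>on_Obj = (\<lambda>a. on_Obj G (on_Obj F a)),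
      on_Hom = (\<lambda>a b f. on_Hom G (on_Obj F a) (on_Obj F b) (on_Hom F a b f))\<rparr>"

definition is_natural_iso ::
  "('o, 'm) category_data \<Rightarrow> ('p, 'n) category_data \<Rightarrow>
   ('o, 'm, 'p, 'n) functor_data \<Rightarrow> ('o, 'm, 'p, 'n) functor_data \<Rightarrow> ('o \<Rightarrow> 'n) \<Rightarrow> bool" where
  "is_natural_iso C D F G \<eta> \<longleftrightarrow>
     (\<forall>a \<in> Obj C. is_iso D (on_Obj F a) (on_Obj G a) (\<eta> a)) \<and>
     (\<forall>a \<in> Obj C. \<forall>b \<in> Obj C. \<forall>f \<in> Hom C a b.
        Cmp D (on_Obj F a) (on_Obj F b) (on_Obj G b) (\<eta> b) (on_Hom F a b f) =
        Cmp D (on_Obj F a) (on_Obj G a) (on_Obj G b) (on_Hom G a b f) (\<eta> a))"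

definition equivalent_categories ::
  "('o, 'm) category_data \<Rightarrow> ('p, 'n) category_data \<Rightarrow> bool" where
  "equivalent_categories C D \<longleftrightarrow>
     (\<exists>F G \<eta> \<epsilon>.
        cat_functor C D F \<and> cat_functor D C G \<and>
        is_natural_iso C C id_functor (comp_functor G F) \<eta> \<and>
        is_natural_iso D D (comp_functor F G) id_functor \<epsilon>)"


section \<open>Monoids with a right normal submonoid\<close>

text \<open>
  Monoids are those of HOL-Algebra, hence written multiplicatively: \<open>x \<otimes>\<^bsub>M\<^esub> y\<close> and \<open>\<one>\<^bsub>M\<^esub>\<close> stand for
  \<open>x + y\<close> and \<open>0\<close>.  No commutativity is assumed.

  All structure-preserving maps are required to be \<open>extensional\<close> (they take the value
  \<open>undefined\<close> outside the carrier of their domain), so that equality of HOL functions is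
  equality of maps between carriers.  The HOL-Algebra set \<open>hom\<close> does not ask for preservation
  of the unit, so this is added.
\<close>

definition monoid_hom :: "('a, 'm) monoid_scheme \<Rightarrow> ('b, 'n) monoid_scheme \<Rightarrow> ('a \<Rightarrow> 'b) set" where
  "monoid_hom M N = {f \<in> hom M N. f \<one>\<^bsub>M\<^esub> = \<one>\<^bsub>N\<^esub> \<and> f \<in> extensional (carrier M)}"

definition End_monoid :: "('a, 'm) monoid_scheme \<Rightarrow> ('a \<Rightarrow> 'a) monoid" where
  "End_monoid M =
     \<lparr>carrier = monoid_hom M M, mult = compose (carrier M), one = (\<lambda>x \<in> carrier M. x)\<rparr>"

definition right_normal :: "'a set \<Rightarrow> ('a, 'm) monoid_scheme \<Rightarrow> bool" where
  "right_normal P M \<longleftrightarrow> submonoid P M \<and> (\<forall>a \<in> carrier M. a <#\<^bsub>M\<^esub> P \<subseteq> P #>\<^bsub>M\<^esub> a)"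

record 'a rn_monoid = "'a monoid" +
  pos :: "'a set"

definition is_rn_monoid :: "'a rn_monoid \<Rightarrow> bool" where
  "is_rn_monoid M \<longleftrightarrow> monoid M \<and> right_normal (pos M) M"

definition rn_hom :: "'a rn_monoid \<Rightarrow> 'b rn_monoid \<Rightarrow> ('a \<Rightarrow> 'b) set" where
  "rn_hom M N = {f \<in> monoid_hom M N. f ` pos M \<subseteq> pos N}"


section \<open>Schreier split extensions\<close>

record 'u split_ext =
  ext_X :: "'u rn_monoid"
  ext_A :: "'u rn_monoid"
  ext_B :: "'u rn_monoid"
  ext_k :: "'u \<Rightarrow> 'u"
  ext_p :: "'u \<Rightarrow> 'u"
  ext_s :: "'u \<Rightarrow> 'u"
  ext_q :: "'u \<Rightarrow> 'u"

text \<open>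
  "\<open>k\<close> is the kernel of \<open>p\<close>" says that the homomorphism \<open>k\<close> maps \<open>X\<close> bijectively onto the
  submonoid \<open>kernel A B p = {a \<in> carrier A. p a = \<one>\<^bsub>B\<^esub>}\<close>.
\<close>

definition is_split_ext :: "'u split_ext \<Rightarrow> bool" where
  "is_split_ext E \<longleftrightarrow>
     (let X = ext_X E; A = ext_A E; B = ext_B E;
          k = ext_k E; p = ext_p E; s = ext_s E; q = ext_q E
      in is_rn_monoid X \<and> is_rn_monoid A \<and> is_rn_monoid B \<and>
         k \<in> rn_hom X A \<and> p \<in> rn_hom A B \<and> s \<in> rn_hom B A \<and>
         q \<in> carrier A \<rightarrow>\<^sub>E carrier X \<and>
         (\<forall>b \<in> carrier B. p (s b) = b) \<and>
         bij_betw k (carrier X) (kernel A B p) \<and>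
         (\<forall>a \<in> carrier A. k (q a) \<otimes>\<^bsub>A\<^esub> s (p a) = a) \<and>
         (\<forall>x \<in> carrier X. \<forall>b \<in> carrier B. q (k x \<otimes>\<^bsub>A\<^esub> s b) = x))"

definition split_ext_hom :: "'u split_ext \<Rightarrow> 'u split_ext \<Rightarrow> (('u \<Rightarrow> 'u) \<times> ('u \<Rightarrow> 'u) \<times> ('u \<Rightarrow> 'u)) set"
  where
  "split_ext_hom E E' =
     {(f0, f1, f2).
        f0 \<in> rn_hom (ext_X E) (ext_X E') \<and>
        f1 \<in> rn_hom (ext_A E) (ext_A E') \<and>
        f2 \<in> rn_hom (ext_B E) (ext_B E') \<and>
        (\<forall>x \<in> carrier (ext_X E). f1 (ext_k E x) = ext_k E' (f0 x)) \<and>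
        (\<forall>a \<in> carrier (ext_A E). ext_p E' (f1 a) = f2 (ext_p E a)) \<and>
        (\<forall>b \<in> carrier (ext_B E). f1 (ext_s E b) = ext_s E' (f2 b)) \<and>
        (\<forall>a \<in> carrier (ext_A E). ext_q E' (f1 a) = f0 (ext_q E a))}"

definition split_ext_cat :: "('u split_ext, ('u \<Rightarrow> 'u) \<times> ('u \<Rightarrow> 'u) \<times> ('u \<Rightarrow> 'u)) category_data" where
  "split_ext_cat =
     \<lparr>Obj = Collect is_split_ext,
      Hom = split_ext_hom,
      Idn = (\<lambda>E. (\<lambda>x \<in> carrier (ext_X E). x, \<lambda>a \<in> carrier (ext_A E). a, \<lambda>b \<in> carrier (ext_B E). b)),
      Cmp = (\<lambda>E E' E'' (g0, g1, g2) (f0, f1, f2).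
        (compose (carrier (ext_X E)) g0 f0,
         compose (carrier (ext_A E)) g1 f1,
         compose (carrier (ext_B E)) g2 f2))\<rparr>"


section \<open>Preordered actions\<close>

record 'u preord_action =
  act_X :: "'u rn_monoid"
  act_B :: "'u rn_monoid"
  act_phi :: "'u \<Rightarrow> 'u \<Rightarrow> 'u"
  act_xi :: "'u \<times> 'u \<Rightarrow> 'u"

definition is_preord_action :: "'u preord_action \<Rightarrow> bool" where
  "is_preord_action T \<longleftrightarrow>
     (let X = act_X T; B = act_B T; \<phi> = act_phi T; \<xi> = act_xi T
      in is_rn_monoid X \<and> is_rn_monoid B \<and>
         \<phi> \<in> monoid_hom B (End_monoid X) \<and>
         \<xi> \<in> carrier X \<times> pos B \<rightarrow>\<^sub>E carrier X \<and>
         (\<forall>b \<in> pos B. \<xi> (\<one>\<^bsub>X\<^esub>, b) = \<one>\<^bsub>X\<^esub>) \<and>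
         (\<forall>x \<in> pos X. \<xi> (x, \<one>\<^bsub>B\<^esub>) = x) \<and>
         (\<forall>x \<in> carrier X. \<forall>x' \<in> carrier X. \<forall>b \<in> pos B. \<forall>b' \<in> pos B.
            \<xi> (x, b) = x \<longrightarrow> \<xi> (x', b') = x' \<longrightarrow>
            \<xi> (x \<otimes>\<^bsub>X\<^esub> \<phi> b x', b \<otimes>\<^bsub>B\<^esub> b') = x \<otimes>\<^bsub>X\<^esub> \<phi> b x') \<and>
         (\<forall>x \<in> carrier X. \<forall>u \<in> carrier X. \<forall>v \<in> pos B. \<forall>b \<in> carrier B.
            \<xi> (u, v) = u \<longrightarrow>
            (\<exists>u' \<in> carrier X. \<exists>v' \<in> pos B.
               b \<otimes>\<^bsub>B\<^esub> v = v' \<otimes>\<^bsub>B\<^esub> b \<and>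
               x \<otimes>\<^bsub>X\<^esub> \<phi> b u = u' \<otimes>\<^bsub>X\<^esub> \<phi> v' x \<and>
               \<xi> (u', v') = u')))"

definition preord_action_hom :: "'u preord_action \<Rightarrow> 'u preord_action \<Rightarrow> (('u \<Rightarrow> 'u) \<times> ('u \<Rightarrow> 'u)) set"
  where
  "preord_action_hom T T' =
     {(f0, f2).
        f0 \<in> rn_hom (act_X T) (act_X T') \<and>
        f2 \<in> rn_hom (act_B T) (act_B T') \<and>
        (\<forall>b \<in> carrier (act_B T). \<forall>x \<in> carrier (act_X T).
           f0 (act_phi T b x) = act_phi T' (f2 b) (f0 x)) \<and>
        (\<forall>u \<in> carrier (act_X T). \<forall>v \<in> pos (act_B T).
           act_xi T (u, v) = u \<longrightarrow> act_xi T' (f0 u, f2 v) = f0 u)}"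

definition preord_action_cat :: "('u preord_action, ('u \<Rightarrow> 'u) \<times> ('u \<Rightarrow> 'u)) category_data" where
  "preord_action_cat =
     \<lparr>Obj = Collect is_preord_action,
      Hom = preord_action_hom,
      Idn = (\<lambda>T. (\<lambda>x \<in> carrier (act_X T). x, \<lambda>b \<in> carrier (act_B T). b)),
      Cmp = (\<lambda>T T' T'' (g0, g2) (f0, f2).
        (compose (carrier (act_X T)) g0 f0, compose (carrier (act_B T)) g2 f2))\<rparr>"

text \<open>
  Both categories consist of structures whose carriers are subsets of one fixed type \<open>'u\<close>, which
  plays the role of the universe of sets over which the category of monoids is formed.  Such a
  universe has to be closed under binary products (semidirect products of monoids must exist
  in it); for a type with at least two elements this amounts to being infinite.
\<close>

end

theory Submission
  imports Defs
begin

text \<open>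
  To a preordered action of \<open>B\<close> on \<open>X\<close> corresponds the semidirect product of \<open>X\<close> and \<open>B\<close>, whose
  positive elements are the pairs \<open>(u, v)\<close> with \<open>v\<close> positive and \<open>\<xi> (u, v) = u\<close>; axioms (A1)--(A4)
  say exactly that these form a right normal submonoid for which the canonical maps are monotone.
  Conversely a Schreier split extension yields \<open>b \<cdot> x = q (s b + k x)\<close>, and \<open>\<xi> (u, v)\<close> is \<open>u\<close> if
  \<open>k u + s v\<close> is positive and \<open>0\<close> otherwise.  Only the fixed points of \<open>\<xi>\<close> matter for morphisms, so
  the identity maps give an isomorphism between an action and the one rebuilt from its semidirect
  product, although the two maps \<open>\<xi>\<close> may differ.  The bijection \<open>(x, b) \<mapsto> k x + s b\<close>, with inverse
  \<open>a \<mapsto> (q a, p a)\<close>, identifies a split extension with the one rebuilt from its action.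
\<close>

section \<open>Morphisms of monoids with a right normal submonoid\<close>

text \<open>Unfolding the two cosets turns their inclusion into the choice of a partner
  \<open>y\<close> for each \<open>a\<close> and \<open>x\<close>. In this elementwise form right
  normality can be compared with (A4).\<close>

lemma right_normal_iff:
  "right_normal P M \<longleftrightarrow>
     P \<subseteq> carrier M \<and> \<one>\<^bsub>M\<^esub> \<in> P \<and> (\<forall>x \<in> P. \<forall>y \<in> P. x \<otimes>\<^bsub>M\<^esub> y \<in> P) \<and>
     (\<forall>a \<in> carrier M. \<forall>x \<in> P. \<exists>y \<in> P. a \<otimes>\<^bsub>M\<^esub> x = y \<otimes>\<^bsub>M\<^esub> a)"
  unfolding right_normal_def submonoid_def l_coset_def r_coset_def by auto blast+

lemma rn_hom_iff:
  "f \<in> rn_hom M N \<longleftrightarrow>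
     f \<in> carrier M \<rightarrow>\<^sub>E carrier N \<and>
     (\<forall>x \<in> carrier M. \<forall>y \<in> carrier M. f (x \<otimes>\<^bsub>M\<^esub> y) = f x \<otimes>\<^bsub>N\<^esub> f y) \<and>
     f \<one>\<^bsub>M\<^esub> = \<one>\<^bsub>N\<^esub> \<and> (\<forall>x \<in> pos M. f x \<in> pos N)"
  unfolding rn_hom_def monoid_hom_def hom_def PiE_def by auto

lemma
  assumes "f \<in> rn_hom M N"
  shows rn_hom_closed: "x \<in> carrier M \<Longrightarrow> f x \<in> carrier N"
    and rn_hom_mult: "\<lbrakk>x \<in> carrier M; y \<in> carrier M\<rbrakk> \<Longrightarrow> f (x \<otimes>\<^bsub>M\<^esub> y) = f x \<otimes>\<^bsub>N\<^esub> f y"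
    and rn_hom_one: "f \<one>\<^bsub>M\<^esub> = \<one>\<^bsub>N\<^esub>"
    and rn_hom_pos: "x \<in> pos M \<Longrightarrow> f x \<in> pos N"
    and rn_hom_extensional: "f \<in> extensional (carrier M)"
  using assms unfolding rn_hom_iff by (auto simp: PiE_def)

lemma is_rn_monoid_pos_subset: "is_rn_monoid M \<Longrightarrow> x \<in> pos M \<Longrightarrow> x \<in> carrier M"
  unfolding is_rn_monoid_def right_normal_iff by auto

lemma rn_hom_id: "is_rn_monoid M \<Longrightarrow> (\<lambda>x \<in> carrier M. x) \<in> rn_hom M M"
  by (auto simp: rn_hom_iff is_rn_monoid_def monoid.m_closed right_normal_iff subset_iff)

lemma rn_hom_compose:
  assumes "is_rn_monoid M" "f \<in> rn_hom M N" "g \<in> rn_hom N P"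
  shows "compose (carrier M) g f \<in> rn_hom M P"
  using assms is_rn_monoid_pos_subset[OF assms(1)]
  by (auto simp: rn_hom_iff compose_def is_rn_monoid_def monoid.m_closed PiE_def Pi_def)

text \<open>Extensionality makes this an equality of HOL functions: off \<open>S\<close> both sides
  are \<open>undefined\<close>.\<close>

lemma compose_restrict_id_right:
  "f \<in> extensional S \<Longrightarrow> compose S f (\<lambda>x \<in> S. x) = f"
  by (auto simp: compose_def extensional_def fun_eq_iff)

lemma compose_restrict_id_left:
  "f \<in> extensional S \<Longrightarrow> (\<And>x. x \<in> S \<Longrightarrow> f x \<in> S') \<Longrightarrow> compose S (\<lambda>x \<in> S'. x) f = f"
  by (auto simp: compose_def extensional_def fun_eq_iff)

text \<open>The hypothesis keeps the values of \<open>f\<close> inside \<open>S'\<close>, where the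
  restricted composite \<open>compose S' h g\<close> really is \<open>h\<close> after
  \<open>g\<close>.\<close>

lemma compose_compose:
  "(\<And>x. x \<in> S \<Longrightarrow> f x \<in> S') \<Longrightarrow> compose S (compose S' h g) f = compose S h (compose S g f)"
  by (auto simp: compose_def fun_eq_iff)

section \<open>The two categories\<close>

lemma split_ext_hom_iff:
  "(f0, f1, f2) \<in> split_ext_hom E E' \<longleftrightarrow>
     f0 \<in> rn_hom (ext_X E) (ext_X E') \<and>
     f1 \<in> rn_hom (ext_A E) (ext_A E') \<and>
     f2 \<in> rn_hom (ext_B E) (ext_B E') \<and>
     (\<forall>x \<in> carrier (ext_X E). f1 (ext_k E x) = ext_k E' (f0 x)) \<and>
     (\<forall>a \<in> carrier (ext_A E). ext_p E' (f1 a) = f2 (ext_p E a)) \<and>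
     (\<forall>b \<in> carrier (ext_B E). f1 (ext_s E b) = ext_s E' (f2 b)) \<and>
     (\<forall>a \<in> carrier (ext_A E). ext_q E' (f1 a) = f0 (ext_q E a))"
  unfolding split_ext_hom_def by simp

lemma preord_action_hom_iff:
  "(f0, f2) \<in> preord_action_hom T T' \<longleftrightarrow>
     f0 \<in> rn_hom (act_X T) (act_X T') \<and>
     f2 \<in> rn_hom (act_B T) (act_B T') \<and>
     (\<forall>b \<in> carrier (act_B T). \<forall>x \<in> carrier (act_X T).
        f0 (act_phi T b x) = act_phi T' (f2 b) (f0 x)) \<and>
     (\<forall>u \<in> carrier (act_X T). \<forall>v \<in> pos (act_B T).
        act_xi T (u, v) = u \<longrightarrow> act_xi T' (f0 u, f2 v) = f0 u)"
  unfolding preord_action_hom_def by simp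

lemma split_ext_cat_simps [simp]:
  "Obj split_ext_cat = Collect is_split_ext"
  "Hom split_ext_cat = split_ext_hom"
  "Idn split_ext_cat E =
     (\<lambda>x \<in> carrier (ext_X E). x, \<lambda>a \<in> carrier (ext_A E). a, \<lambda>b \<in> carrier (ext_B E). b)"
  "Cmp split_ext_cat E E' E'' (g0, g1, g2) (f0, f1, f2) =
     (compose (carrier (ext_X E)) g0 f0,
      compose (carrier (ext_A E)) g1 f1,
      compose (carrier (ext_B E)) g2 f2)"
  unfolding split_ext_cat_def by simp_all

lemma preord_action_cat_simps [simp]:
  "Obj preord_action_cat = Collect is_preord_action"
  "Hom preord_action_cat = preord_action_hom"
  "Idn preord_action_cat T = (\<lambda>x \<in> carrier (act_X T). x, \<lambda>b \<in> carrier (act_B T). b)"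
  "Cmp preord_action_cat T T' T'' (g0, g2) (f0, f2) =
     (compose (carrier (act_X T)) g0 f0, compose (carrier (act_B T)) g2 f2)"
  unfolding preord_action_cat_def by simp_all

section \<open>Calculus of normal forms in a Schreier split extension\<close>

locale split_extension =
  fixes E :: "'u split_ext"
  assumes is_split_ext: "is_split_ext E"
begin

abbreviation "X \<equiv> ext_X E"
abbreviation "A \<equiv> ext_A E"
abbreviation "B \<equiv> ext_B E"
abbreviation "k \<equiv> ext_k E"
abbreviation "p \<equiv> ext_p E"
abbreviation "s \<equiv> ext_s E"
abbreviation "q \<equiv> ext_q E"

lemma
  shows X_rn: "is_rn_monoid X" and A_rn: "is_rn_monoid A" and B_rn: "is_rn_monoid B"
    and k_hom: "k \<in> rn_hom X A" and p_hom: "p \<in> rn_hom A B" and s_hom: "s \<in> rn_hom B A"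
    and q_funcset: "q \<in> carrier A \<rightarrow>\<^sub>E carrier X"
    and p_s: "b \<in> carrier B \<Longrightarrow> p (s b) = b"
    and k_bij: "bij_betw k (carrier X) (kernel A B p)"
    and S1: "a \<in> carrier A \<Longrightarrow> k (q a) \<otimes>\<^bsub>A\<^esub> s (p a) = a"
    and S2: "x \<in> carrier X \<Longrightarrow> b \<in> carrier B \<Longrightarrow> q (k x \<otimes>\<^bsub>A\<^esub> s b) = x"
  using is_split_ext unfolding is_split_ext_def Let_def by auto

sublocale X: monoid X using X_rn by (simp add: is_rn_monoid_def)
sublocale A: monoid A using A_rn by (simp add: is_rn_monoid_def)
sublocale B: monoid B using B_rn by (simp add: is_rn_monoid_def)

lemma closed [simp]:
  "x \<in> carrier X \<Longrightarrow> k x \<in> carrier A"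
  "a \<in> carrier A \<Longrightarrow> p a \<in> carrier B"
  "b \<in> carrier B \<Longrightarrow> s b \<in> carrier A"
  "a \<in> carrier A \<Longrightarrow> q a \<in> carrier X"
  using k_hom p_hom s_hom q_funcset by (auto simp: rn_hom_iff)

lemma pos_closed:
  "x \<in> pos X \<Longrightarrow> x \<in> carrier X" "a \<in> pos A \<Longrightarrow> a \<in> carrier A" "b \<in> pos B \<Longrightarrow> b \<in> carrier B"
  using X_rn A_rn B_rn by (simp_all add: is_rn_monoid_pos_subset)

lemma p_k [simp]: "x \<in> carrier X \<Longrightarrow> p (k x) = \<one>\<^bsub>B\<^esub>"
  using k_bij unfolding bij_betw_def kernel_def by auto

lemma p_k_s: "x \<in> carrier X \<Longrightarrow> b \<in> carrier B \<Longrightarrow> p (k x \<otimes>\<^bsub>A\<^esub> s b) = b"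
  by (simp add: rn_hom_mult[OF p_hom] p_s)

lemma q_k: "x \<in> carrier X \<Longrightarrow> q (k x) = x"
  using S2[of x "\<one>\<^bsub>B\<^esub>"] by (simp add: rn_hom_one[OF s_hom])

lemma q_s: "b \<in> carrier B \<Longrightarrow> q (s b) = \<one>\<^bsub>X\<^esub>"
  using S2[of "\<one>\<^bsub>X\<^esub>" b] by (simp add: rn_hom_one[OF k_hom])

text \<open>A substitute for conjugating \<open>k x\<close> by \<open>s b\<close>, which would
  require an inverse of \<open>s b\<close>.\<close>

definition act :: "'u \<Rightarrow> 'u \<Rightarrow> 'u" where
  "act b x = q (s b \<otimes>\<^bsub>A\<^esub> k x)"

lemma act_closed [simp]: "b \<in> carrier B \<Longrightarrow> x \<in> carrier X \<Longrightarrow> act b x \<in> carrier X"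
  by (simp add: act_def)

text \<open>This is (S1) for the element \<open>s b + k x\<close>, whose image under
  \<open>p\<close> is \<open>b\<close>. As a rewrite rule it moves \<open>s\<close> to the right of
  \<open>k\<close>.\<close>

lemma s_k_swap:
  assumes "b \<in> carrier B" "x \<in> carrier X"
  shows "s b \<otimes>\<^bsub>A\<^esub> k x = k (act b x) \<otimes>\<^bsub>A\<^esub> s b"
  using S1[of "s b \<otimes>\<^bsub>A\<^esub> k x"] assms by (simp add: act_def rn_hom_mult[OF p_hom] p_s)

text \<open>Swapping the two inner factors brings the product to normal form. The result is the
  multiplication rule of a semidirect product.\<close>

lemma k_s_mult:
  assumes [simp]: "x \<in> carrier X" "b \<in> carrier B" "x' \<in> carrier X" "b' \<in> carrier B"
  shows "(k x \<otimes>\<^bsub>A\<^esub> s b) \<otimes>\<^bsub>A\<^esub> (k x' \<otimes>\<^bsub>A\<^esub> s b') =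
    k (x \<otimes>\<^bsub>X\<^esub> act b x') \<otimes>\<^bsub>A\<^esub> s (b \<otimes>\<^bsub>B\<^esub> b')"
proof -
  have "(k x \<otimes>\<^bsub>A\<^esub> s b) \<otimes>\<^bsub>A\<^esub> (k x' \<otimes>\<^bsub>A\<^esub> s b') = k x \<otimes>\<^bsub>A\<^esub> (s b \<otimes>\<^bsub>A\<^esub> k x') \<otimes>\<^bsub>A\<^esub> s b'"
    by (simp add: A.m_assoc)
  also have "\<dots> = k (x \<otimes>\<^bsub>X\<^esub> act b x') \<otimes>\<^bsub>A\<^esub> s (b \<otimes>\<^bsub>B\<^esub> b')"
    by (simp add: s_k_swap A.m_assoc rn_hom_mult[OF k_hom] rn_hom_mult[OF s_hom])
  finally show ?thesis .
qed

text \<open>Normal forms are unique because \<open>q\<close> reads off the first component by (S2)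
  and \<open>p\<close> the second.\<close>

lemma k_s_cancel:
  assumes "x \<in> carrier X" "b \<in> carrier B" "x' \<in> carrier X" "b' \<in> carrier B"
    "k x \<otimes>\<^bsub>A\<^esub> s b = k x' \<otimes>\<^bsub>A\<^esub> s b'"
  shows "x = x'" "b = b'"
  using assms by (metis S2, metis p_k_s)

lemma act_one_left: "x \<in> carrier X \<Longrightarrow> act \<one>\<^bsub>B\<^esub> x = x"
  by (simp add: act_def rn_hom_one[OF s_hom] q_k)

lemma act_one_right: "b \<in> carrier B \<Longrightarrow> act b \<one>\<^bsub>X\<^esub> = \<one>\<^bsub>X\<^esub>"
  by (simp add: act_def rn_hom_one[OF k_hom] q_s)

text \<open>Moving \<open>s b\<close> past \<open>k x\<close> and then past \<open>k y\<close> gives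
  a normal form of \<open>s b + k (x + y)\<close>, from which \<open>q\<close> extracts the
  claim.\<close>

lemma act_mult_right:
  assumes [simp]: "b \<in> carrier B" "x \<in> carrier X" "y \<in> carrier X"
  shows "act b (x \<otimes>\<^bsub>X\<^esub> y) = act b x \<otimes>\<^bsub>X\<^esub> act b y"
proof -
  have "s b \<otimes>\<^bsub>A\<^esub> k (x \<otimes>\<^bsub>X\<^esub> y) = (s b \<otimes>\<^bsub>A\<^esub> k x) \<otimes>\<^bsub>A\<^esub> k y"
    by (simp add: A.m_assoc rn_hom_mult[OF k_hom])
  also have "\<dots> = k (act b x) \<otimes>\<^bsub>A\<^esub> (s b \<otimes>\<^bsub>A\<^esub> k y)"
    by (simp add: A.m_assoc s_k_swap)
  also have "\<dots> = k (act b x \<otimes>\<^bsub>X\<^esub> act b y) \<otimes>\<^bsub>A\<^esub> s b"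
    by (simp add: A.m_assoc s_k_swap rn_hom_mult[OF k_hom])
  finally show ?thesis by (simp add: act_def[of b "x \<otimes>\<^bsub>X\<^esub> y"] S2)
qed

text \<open>Here \<open>k x\<close> stays and two section elements pass it: first
  \<open>s b'\<close>, then \<open>s b\<close>. Again \<open>q\<close> extracts the first
  component.\<close>

lemma act_mult_left:
  assumes [simp]: "b \<in> carrier B" "b' \<in> carrier B" "x \<in> carrier X"
  shows "act (b \<otimes>\<^bsub>B\<^esub> b') x = act b (act b' x)"
proof -
  have "s (b \<otimes>\<^bsub>B\<^esub> b') \<otimes>\<^bsub>A\<^esub> k x = s b \<otimes>\<^bsub>A\<^esub> (s b' \<otimes>\<^bsub>A\<^esub> k x)"
    by (simp add: A.m_assoc rn_hom_mult[OF s_hom])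
  also have "\<dots> = (s b \<otimes>\<^bsub>A\<^esub> k (act b' x)) \<otimes>\<^bsub>A\<^esub> s b'"
    by (subst s_k_swap) (simp_all add: A.m_assoc)
  also have "\<dots> = k (act b (act b' x)) \<otimes>\<^bsub>A\<^esub> s (b \<otimes>\<^bsub>B\<^esub> b')"
    by (simp add: s_k_swap) (simp add: A.m_assoc rn_hom_mult[OF s_hom])
  finally show ?thesis by (simp add: act_def[of "b \<otimes>\<^bsub>B\<^esub> b'"] S2)
qed

end

interpretation split_ext_cat: category split_ext_cat
proof
  fix E :: "'u split_ext"
  assume "E \<in> Obj split_ext_cat"
  then interpret split_extension E by unfold_locales simp
  show "Idn split_ext_cat E \<in> Hom split_ext_cat E E"
    by (simp add: split_ext_hom_iff rn_hom_id X_rn A_rn B_rn)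
next
  fix E E' E'' :: "'u split_ext" and f g
  assume obj: "E \<in> Obj split_ext_cat" "E' \<in> Obj split_ext_cat" "E'' \<in> Obj split_ext_cat"
    and homs: "f \<in> Hom split_ext_cat E E'" "g \<in> Hom split_ext_cat E' E''"
  interpret split_extension E using obj by unfold_locales simp
  show "Cmp split_ext_cat E E' E'' g f \<in> Hom split_ext_cat E E''"
    using homs
    by (cases f; cases g)
      (auto simp: split_ext_hom_iff rn_hom_compose X_rn A_rn B_rn compose_eq rn_hom_closed)
next
  fix E E' :: "'u split_ext" and f
  assume "f \<in> Hom split_ext_cat E E'"
  then show "Cmp split_ext_cat E E E' f (Idn split_ext_cat E) = f"
    by (cases f) (auto simp: split_ext_hom_iff compose_restrict_id_right rn_hom_extensional)
next
  fix E E' :: "'u split_ext" and f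
  assume "f \<in> Hom split_ext_cat E E'"
  then show "Cmp split_ext_cat E E' E' (Idn split_ext_cat E') f = f"
    by (cases f)
      (auto simp: split_ext_hom_iff compose_restrict_id_left rn_hom_extensional rn_hom_closed)
next
  fix E1 E2 E3 E4 :: "'u split_ext" and f g h
  assume "f \<in> Hom split_ext_cat E1 E2"
  then show "Cmp split_ext_cat E1 E2 E4 (Cmp split_ext_cat E2 E3 E4 h g) f =
    Cmp split_ext_cat E1 E3 E4 h (Cmp split_ext_cat E1 E2 E3 g f)"
    by (cases f; cases g; cases h) (auto simp: split_ext_hom_iff compose_compose rn_hom_closed)
qed

section \<open>Preordered actions: axioms in pointwise form, and their category\<close>

locale preordered_action =
  fixes T :: "'u preord_action"
  assumes is_preord_action: "is_preord_action T"
begin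

abbreviation "X \<equiv> act_X T"
abbreviation "B \<equiv> act_B T"
abbreviation "\<phi> \<equiv> act_phi T"
abbreviation "\<xi> \<equiv> act_xi T"

lemma
  shows X_rn: "is_rn_monoid X" and B_rn: "is_rn_monoid B"
    and phi_hom: "\<phi> \<in> monoid_hom B (End_monoid X)"
    and A1: "v \<in> pos B \<Longrightarrow> \<xi> (\<one>\<^bsub>X\<^esub>, v) = \<one>\<^bsub>X\<^esub>"
    and A2: "x \<in> pos X \<Longrightarrow> \<xi> (x, \<one>\<^bsub>B\<^esub>) = x"
    and A3: "\<lbrakk>x \<in> carrier X; x' \<in> carrier X; v \<in> pos B; v' \<in> pos B;
        \<xi> (x, v) = x; \<xi> (x', v') = x'\<rbrakk>
      \<Longrightarrow> \<xi> (x \<otimes>\<^bsub>X\<^esub> \<phi> v x', v \<otimes>\<^bsub>B\<^esub> v') = x \<otimes>\<^bsub>X\<^esub> \<phi> v x'"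
    and A4: "\<lbrakk>x \<in> carrier X; u \<in> carrier X; v \<in> pos B; b \<in> carrier B; \<xi> (u, v) = u\<rbrakk>
      \<Longrightarrow> \<exists>u' \<in> carrier X. \<exists>v' \<in> pos B. b \<otimes>\<^bsub>B\<^esub> v = v' \<otimes>\<^bsub>B\<^esub> b \<and>
            x \<otimes>\<^bsub>X\<^esub> \<phi> b u = u' \<otimes>\<^bsub>X\<^esub> \<phi> v' x \<and> \<xi> (u', v') = u'"
  using is_preord_action unfolding is_preord_action_def Let_def by auto

sublocale X: monoid X using X_rn by (simp add: is_rn_monoid_def)
sublocale B: monoid B using B_rn by (simp add: is_rn_monoid_def)

lemma pos_closed:
  "x \<in> pos X \<Longrightarrow> x \<in> carrier X" "b \<in> pos B \<Longrightarrow> b \<in> carrier B"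
  using X_rn B_rn by (simp_all add: is_rn_monoid_pos_subset)

lemma pos_one: "\<one>\<^bsub>X\<^esub> \<in> pos X" "\<one>\<^bsub>B\<^esub> \<in> pos B"
  using X_rn B_rn by (simp_all add: is_rn_monoid_def right_normal_iff)

lemma pos_mult: "v \<in> pos B \<Longrightarrow> v' \<in> pos B \<Longrightarrow> v \<otimes>\<^bsub>B\<^esub> v' \<in> pos B"
  using B_rn by (simp add: is_rn_monoid_def right_normal_iff)

lemma phi_End: "b \<in> carrier B \<Longrightarrow> \<phi> b \<in> monoid_hom X X"
  \<comment> \<open>Only the outer occurrence, with domain \<open>B\<close>, is unfolded, so that
    the carrier of \<open>End_monoid X\<close> remains visible as
    \<open>monoid_hom X X\<close>.\<close>
  using phi_hom unfolding monoid_hom_def[of B] hom_def by (auto simp: End_monoid_def)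

lemma phi_closed [simp]: "b \<in> carrier B \<Longrightarrow> x \<in> carrier X \<Longrightarrow> \<phi> b x \<in> carrier X"
  using phi_End by (auto simp: monoid_hom_def hom_def)

lemma phi_mult_right:
  "b \<in> carrier B \<Longrightarrow> x \<in> carrier X \<Longrightarrow> y \<in> carrier X \<Longrightarrow> \<phi> b (x \<otimes>\<^bsub>X\<^esub> y) = \<phi> b x \<otimes>\<^bsub>X\<^esub> \<phi> b y"
  using phi_End by (auto simp: monoid_hom_def hom_def)

lemma phi_one_right: "b \<in> carrier B \<Longrightarrow> \<phi> b \<one>\<^bsub>X\<^esub> = \<one>\<^bsub>X\<^esub>"
  using phi_End by (auto simp: monoid_hom_def)

lemma phi_mult_left:
  "b \<in> carrier B \<Longrightarrow> b' \<in> carrier B \<Longrightarrow> x \<in> carrier X \<Longrightarrow> \<phi> (b \<otimes>\<^bsub>B\<^esub> b') x = \<phi> b (\<phi> b' x)"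
  using phi_hom unfolding monoid_hom_def[of B] hom_def by (auto simp: End_monoid_def compose_eq)

lemma phi_one_left: "x \<in> carrier X \<Longrightarrow> \<phi> \<one>\<^bsub>B\<^esub> x = x"
  using phi_hom unfolding monoid_hom_def[of B] by (auto simp: End_monoid_def)

end

interpretation preord_action_cat: category preord_action_cat
proof
  fix T :: "'u preord_action"
  assume "T \<in> Obj preord_action_cat"
  then interpret preordered_action T by unfold_locales simp
  show "Idn preord_action_cat T \<in> Hom preord_action_cat T T"
    by (simp add: preord_action_hom_iff rn_hom_id X_rn B_rn pos_closed)
next
  fix T T' T'' :: "'u preord_action" and f g
  assume obj: "T \<in> Obj preord_action_cat" "T' \<in> Obj preord_action_cat"
      "T'' \<in> Obj preord_action_cat"
    and homs: "f \<in> Hom preord_action_cat T T'" "g \<in> Hom preord_action_cat T' T''"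
  interpret preordered_action T using obj by unfold_locales simp
  \<comment> \<open>Preservation of fixed points of \<open>\<xi>\<close> can be chained because the
    first map sends \<open>pos B\<close> into the positive elements of the second action, where the
    condition on \<open>g\<close> applies.\<close>
  show "Cmp preord_action_cat T T' T'' g f \<in> Hom preord_action_cat T T''"
    using homs
    by (cases f; cases g)
      (auto simp: preord_action_hom_iff rn_hom_compose X_rn B_rn compose_eq rn_hom_closed
        rn_hom_pos pos_closed)
next
  fix T T' :: "'u preord_action" and f
  assume "f \<in> Hom preord_action_cat T T'"
  then show "Cmp preord_action_cat T T T' f (Idn preord_action_cat T) = f"
    by (cases f) (auto simp: preord_action_hom_iff compose_restrict_id_right rn_hom_extensional)
next
  fix T T' :: "'u preord_action" and f
  assume "f \<in> Hom preord_action_cat T T'"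
  then show "Cmp preord_action_cat T T' T' (Idn preord_action_cat T') f = f"
    by (cases f)
      (auto simp: preord_action_hom_iff compose_restrict_id_left rn_hom_extensional rn_hom_closed)
next
  fix T1 T2 T3 T4 :: "'u preord_action" and f g h
  assume "f \<in> Hom preord_action_cat T1 T2"
  then show "Cmp preord_action_cat T1 T2 T4 (Cmp preord_action_cat T2 T3 T4 h g) f =
    Cmp preord_action_cat T1 T3 T4 h (Cmp preord_action_cat T1 T2 T3 g f)"
    by (cases f; cases g; cases h) (auto simp: preord_action_hom_iff compose_compose rn_hom_closed)
qed

section \<open>The action of a split extension\<close>

definition action_of :: "'u split_ext \<Rightarrow> 'u preord_action" where
  "action_of E =
     \<lparr>act_X = ext_X E,
      act_B = ext_B E,
      act_phi = (\<lambda>b \<in> carrier (ext_B E). \<lambda>x \<in> carrier (ext_X E).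
        ext_q E (ext_s E b \<otimes>\<^bsub>ext_A E\<^esub> ext_k E x)),
      act_xi = (\<lambda>(u, v) \<in> carrier (ext_X E) \<times> pos (ext_B E).
        if ext_k E u \<otimes>\<^bsub>ext_A E\<^esub> ext_s E v \<in> pos (ext_A E) then u else \<one>\<^bsub>ext_X E\<^esub>)\<rparr>"

lemma action_of_simps [simp]:
  "act_X (action_of E) = ext_X E"
  "act_B (action_of E) = ext_B E"
  by (simp_all add: action_of_def)

context split_extension
begin

lemma phi_action_of [simp]:
  "b \<in> carrier B \<Longrightarrow> x \<in> carrier X \<Longrightarrow> act_phi (action_of E) b x = act b x"
  by (simp add: action_of_def act_def)

text \<open>
  The junk value \<open>\<one>\<close> in the definition of \<open>\<xi>\<close> creates no further fixed point, because \<open>s\<close> maps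
  \<open>pos B\<close> into \<open>pos A\<close>.
\<close>

lemma xi_action_of:
  assumes "u \<in> carrier X" "v \<in> pos B"
  shows "act_xi (action_of E) (u, v) = u \<longleftrightarrow> k u \<otimes>\<^bsub>A\<^esub> s v \<in> pos A"
  using assms rn_hom_pos[OF s_hom, of v]
  by (auto simp: action_of_def rn_hom_one[OF k_hom] pos_closed)

lemma phi_action_of_hom: "act_phi (action_of E) \<in> monoid_hom B (End_monoid X)"
proof -
  have "act_phi (action_of E) b \<in> monoid_hom X X" if "b \<in> carrier B" for b
    using that by (auto simp: monoid_hom_def hom_def act_one_right act_mult_right)
      (simp add: action_of_def)
  moreover have "act_phi (action_of E) (b \<otimes>\<^bsub>B\<^esub> b') =
      compose (carrier X) (act_phi (action_of E) b) (act_phi (action_of E) b')"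
    if "b \<in> carrier B" "b' \<in> carrier B" for b b'
    using that act_mult_left[OF that] unfolding act_def
    by (auto simp: action_of_def compose_def fun_eq_iff)
  moreover have "act_phi (action_of E) \<one>\<^bsub>B\<^esub> = (\<lambda>x \<in> carrier X. x)"
    using act_one_left unfolding act_def by (auto simp: action_of_def fun_eq_iff)
  moreover have "act_phi (action_of E) \<in> extensional (carrier B)"
    by (simp add: action_of_def)
  ultimately show ?thesis
    unfolding monoid_hom_def[of B] hom_def by (auto simp: End_monoid_def)
qed

text \<open>Right normality of \<open>pos A\<close>, applied to \<open>k x + s b\<close> and the
  positive element \<open>k u + s v\<close>, yields a positive \<open>a\<close> with
  \<open>(k x + s b) + (k u + s v) = a + (k x + s b)\<close>. The witnesses are its components
  \<open>q a\<close> and \<open>p a\<close>; comparing the normal forms of both sides gives the two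
  equations.\<close>

lemma action_of_A4:
  assumes "x \<in> carrier X" "u \<in> carrier X" "v \<in> pos B" "b \<in> carrier B" "k u \<otimes>\<^bsub>A\<^esub> s v \<in> pos A"
  obtains u' v' where "u' \<in> carrier X" "v' \<in> pos B" "b \<otimes>\<^bsub>B\<^esub> v = v' \<otimes>\<^bsub>B\<^esub> b"
    "x \<otimes>\<^bsub>X\<^esub> act b u = u' \<otimes>\<^bsub>X\<^esub> act v' x" "k u' \<otimes>\<^bsub>A\<^esub> s v' \<in> pos A"
proof -
  have "k x \<otimes>\<^bsub>A\<^esub> s b \<in> carrier A" using assms by simp
  then obtain a where a: "a \<in> pos A"
    and eq: "(k x \<otimes>\<^bsub>A\<^esub> s b) \<otimes>\<^bsub>A\<^esub> (k u \<otimes>\<^bsub>A\<^esub> s v) = a \<otimes>\<^bsub>A\<^esub> (k x \<otimes>\<^bsub>A\<^esub> s b)"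
    using A_rn assms(5) unfolding is_rn_monoid_def right_normal_iff by blast
  have ac: "a \<in> carrier A" using a by (rule pos_closed)
  have vc: "v \<in> carrier B" using assms(3) by (rule pos_closed)
  have "k (x \<otimes>\<^bsub>X\<^esub> act b u) \<otimes>\<^bsub>A\<^esub> s (b \<otimes>\<^bsub>B\<^esub> v) =
      k (q a \<otimes>\<^bsub>X\<^esub> act (p a) x) \<otimes>\<^bsub>A\<^esub> s (p a \<otimes>\<^bsub>B\<^esub> b)"
    using assms ac vc eq k_s_mult[of "q a" "p a" x b] by (simp add: k_s_mult S1)
  then have "x \<otimes>\<^bsub>X\<^esub> act b u = q a \<otimes>\<^bsub>X\<^esub> act (p a) x" "b \<otimes>\<^bsub>B\<^esub> v = p a \<otimes>\<^bsub>B\<^esub> b"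
    \<comment> \<open>The rotation makes the equation of normal forms the first premise, so that it
      determines the four components before their membership is checked.\<close>
    by (rule k_s_cancel[rotated 4]; use assms ac vc in simp)+
  then show thesis
    using that[of "q a" "p a"] a ac rn_hom_pos[OF p_hom a] by (simp add: S1)
qed

lemma is_preord_action_action_of: "is_preord_action (action_of E)"
proof -
  have "act_xi (action_of E) \<in> carrier X \<times> pos B \<rightarrow>\<^sub>E carrier X"
    by (auto simp: action_of_def)
  \<comment> \<open>At \<open>u = \<one>\<close> both branches of the conditional give
    \<open>\<one>\<close>: the default value was chosen so that (A1) holds.\<close>
  moreover have "act_xi (action_of E) (\<one>\<^bsub>X\<^esub>, v) = \<one>\<^bsub>X\<^esub>" if "v \<in> pos B" for v
    using that by (simp add: action_of_def)
  moreover have "act_xi (action_of E) (x, \<one>\<^bsub>B\<^esub>) = x" if "x \<in> pos X" for x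
    using that rn_hom_pos[OF k_hom that] B_rn
    by (subst xi_action_of)
      (auto simp: pos_closed rn_hom_one[OF s_hom] is_rn_monoid_def right_normal_iff)
  moreover have "act_xi (action_of E) (x \<otimes>\<^bsub>X\<^esub> act v x', v \<otimes>\<^bsub>B\<^esub> v') = x \<otimes>\<^bsub>X\<^esub> act v x'"
    if "x \<in> carrier X" "x' \<in> carrier X" "v \<in> pos B" "v' \<in> pos B"
      "act_xi (action_of E) (x, v) = x" "act_xi (action_of E) (x', v') = x'" for x x' v v'
  proof -
    \<comment> \<open>(A3) is closure of \<open>pos A\<close> under the operation, read through
      \<open>k_s_mult\<close>.\<close>
    have "(k x \<otimes>\<^bsub>A\<^esub> s v) \<otimes>\<^bsub>A\<^esub> (k x' \<otimes>\<^bsub>A\<^esub> s v') \<in> pos A"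
      using that A_rn by (simp add: xi_action_of is_rn_monoid_def right_normal_iff)
    moreover have "v \<otimes>\<^bsub>B\<^esub> v' \<in> pos B"
      using that B_rn by (simp add: is_rn_monoid_def right_normal_iff)
    ultimately show ?thesis
      using that by (simp add: xi_action_of k_s_mult pos_closed)
  qed
  moreover have "\<exists>u' \<in> carrier X. \<exists>v' \<in> pos B. b \<otimes>\<^bsub>B\<^esub> v = v' \<otimes>\<^bsub>B\<^esub> b \<and>
        x \<otimes>\<^bsub>X\<^esub> act b u = u' \<otimes>\<^bsub>X\<^esub> act v' x \<and> act_xi (action_of E) (u', v') = u'"
    if "x \<in> carrier X" "u \<in> carrier X" "v \<in> pos B" "b \<in> carrier B"
      "act_xi (action_of E) (u, v) = u" for x u v b
    using action_of_A4[of x u v b] that by (metis xi_action_of)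
  ultimately show ?thesis
    using X_rn B_rn phi_action_of_hom pos_closed
    unfolding is_preord_action_def Let_def by simp
qed

end

section \<open>The functor from split extensions to actions\<close>

definition action_functor ::
  "('u split_ext, ('u \<Rightarrow> 'u) \<times> ('u \<Rightarrow> 'u) \<times> ('u \<Rightarrow> 'u), 'u preord_action, ('u \<Rightarrow> 'u) \<times> ('u \<Rightarrow> 'u))
     functor_data" where
  "action_functor = \<lparr>on_Obj = action_of, on_Hom = (\<lambda>E E' (f0, f1, f2). (f0, f2))\<rparr>"

text \<open>Equivariance is the identity \<open>q' f1 = f0 q\<close> evaluated at
  \<open>s b + k x\<close>. Fixed points of \<open>\<xi>\<close> are preserved because
  \<open>f1\<close> sends the positive element \<open>k u + s v\<close> to the positive element
  \<open>k' (f0 u) + s' (f2 v)\<close>.\<close>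

lemma action_of_hom:
  assumes "is_split_ext E" "is_split_ext E'" "(f0, f1, f2) \<in> split_ext_hom E E'"
  shows "(f0, f2) \<in> preord_action_hom (action_of E) (action_of E')"
proof -
  interpret E: split_extension E using assms by unfold_locales
  interpret E': split_extension E' using assms by unfold_locales
  have f: "f0 \<in> rn_hom E.X E'.X" "f1 \<in> rn_hom E.A E'.A" "f2 \<in> rn_hom E.B E'.B"
    and k: "\<And>x. x \<in> carrier E.X \<Longrightarrow> f1 (E.k x) = E'.k (f0 x)"
    and s: "\<And>b. b \<in> carrier E.B \<Longrightarrow> f1 (E.s b) = E'.s (f2 b)"
    and q: "\<And>a. a \<in> carrier E.A \<Longrightarrow> E'.q (f1 a) = f0 (E.q a)"
    using assms(3) by (auto simp: split_ext_hom_iff)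
  note [simp] = f[THEN rn_hom_closed] f[THEN rn_hom_mult] f[THEN rn_hom_pos]
  have "f0 (E.act b x) = E'.act (f2 b) (f0 x)" if "b \<in> carrier E.B" "x \<in> carrier E.X" for b x
    using that q[of "E.s b \<otimes>\<^bsub>E.A\<^esub> E.k x"] by (simp add: E.act_def E'.act_def k s)
  moreover have "E'.k (f0 u) \<otimes>\<^bsub>E'.A\<^esub> E'.s (f2 v) \<in> pos E'.A"
    if "u \<in> carrier E.X" "v \<in> pos E.B" "E.k u \<otimes>\<^bsub>E.A\<^esub> E.s v \<in> pos E.A" for u v
    using that rn_hom_pos[OF f(2) that(3)] by (simp add: k s E.pos_closed)
  ultimately show ?thesis
    using f by (simp add: preord_action_hom_iff E.xi_action_of E'.xi_action_of)
qed

lemma cat_functor_action_functor: "cat_functor split_ext_cat preord_action_cat action_functor"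
  by unfold_locales
    (auto simp: action_functor_def action_of_hom split_extension.is_preord_action_action_of
      split_extension_def)

section \<open>The semidirect product\<close>

text \<open>
  The carrier of the semidirect product has to live in the same type as the given monoids, so pairs
  are coded by an injection \<open>e\<close>.
\<close>

definition semidirect :: "('u \<times> 'u \<Rightarrow> 'u) \<Rightarrow> 'u preord_action \<Rightarrow> 'u rn_monoid" where
  "semidirect e T =
     \<lparr>carrier = e ` (carrier (act_X T) \<times> carrier (act_B T)),
      mult = (\<lambda>c d. case (the_inv e c, the_inv e d) of ((x, b), (x', b')) \<Rightarrow>
        e (x \<otimes>\<^bsub>act_X T\<^esub> act_phi T b x', b \<otimes>\<^bsub>act_B T\<^esub> b')),
      one = e (\<one>\<^bsub>act_X T\<^esub>, \<one>\<^bsub>act_B T\<^esub>),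
      pos = e ` {(u, v). u \<in> carrier (act_X T) \<and> v \<in> pos (act_B T) \<and> act_xi T (u, v) = u}\<rparr>"

text \<open>The canonical injections and projections of the semidirect product. The first projection
  serves as the Schreier map \<open>q\<close>; in general it is not a homomorphism.\<close>

definition ext_of :: "('u \<times> 'u \<Rightarrow> 'u) \<Rightarrow> 'u preord_action \<Rightarrow> 'u split_ext" where
  "ext_of e T =
     \<lparr>ext_X = act_X T,
      ext_A = semidirect e T,
      ext_B = act_B T,
      ext_k = (\<lambda>x \<in> carrier (act_X T). e (x, \<one>\<^bsub>act_B T\<^esub>)),
      ext_p = (\<lambda>c \<in> carrier (semidirect e T). snd (the_inv e c)),
      ext_s = (\<lambda>b \<in> carrier (act_B T). e (\<one>\<^bsub>act_X T\<^esub>, b)),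
      ext_q = (\<lambda>c \<in> carrier (semidirect e T). fst (the_inv e c))\<rparr>"

text \<open>The middle component is forced: the code of \<open>(x, b)\<close> is
  \<open>k x + s b\<close>, and a morphism of extensions must send this to
  \<open>k' (f0 x) + s' (f2 b)\<close>.\<close>

definition ext_functor ::
  "('u \<times> 'u \<Rightarrow> 'u) \<Rightarrow>
   ('u preord_action, ('u \<Rightarrow> 'u) \<times> ('u \<Rightarrow> 'u), 'u split_ext, ('u \<Rightarrow> 'u) \<times> ('u \<Rightarrow> 'u) \<times> ('u \<Rightarrow> 'u))
     functor_data" where
  "ext_functor e =
     \<lparr>on_Obj = ext_of e,
      on_Hom = (\<lambda>T T' (f0, f2).
        (f0, \<lambda>c \<in> carrier (semidirect e T). case the_inv e c of (x, b) \<Rightarrow> e (f0 x, f2 b), f2))\<rparr>"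

lemma ext_of_simps [simp]:
  "ext_X (ext_of e T) = act_X T"
  "ext_A (ext_of e T) = semidirect e T"
  "ext_B (ext_of e T) = act_B T"
  by (simp_all add: ext_of_def)

section \<open>Computing in the semidirect product through coded pairs\<close>

locale pairing =
  fixes e :: "'u \<times> 'u \<Rightarrow> 'u"
  assumes inj_e: "inj e"
begin

lemma inv_e [simp]: "the_inv e (e z) = z"
  by (simp add: inj_e the_inv_f_f)

lemma e_eq_iff [simp]: "e z = e z' \<longleftrightarrow> z = z'"
  using inj_e by (auto dest: injD)

lemma e_in_carrier [simp]:
  "e (x, b) \<in> carrier (semidirect e T) \<longleftrightarrow> x \<in> carrier (act_X T) \<and> b \<in> carrier (act_B T)"
  by (auto simp: semidirect_def)

lemma e_in_pos [simp]:
  "e (u, v) \<in> pos (semidirect e T) \<longleftrightarrow>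
     u \<in> carrier (act_X T) \<and> v \<in> pos (act_B T) \<and> act_xi T (u, v) = u"
  by (auto simp: semidirect_def)

lemma mult_semidirect [simp]:
  "e (x, b) \<otimes>\<^bsub>semidirect e T\<^esub> e (x', b') =
     e (x \<otimes>\<^bsub>act_X T\<^esub> act_phi T b x', b \<otimes>\<^bsub>act_B T\<^esub> b')"
  by (simp add: semidirect_def)

lemma one_semidirect: "\<one>\<^bsub>semidirect e T\<^esub> = e (\<one>\<^bsub>act_X T\<^esub>, \<one>\<^bsub>act_B T\<^esub>)"
  by (simp add: semidirect_def)

text \<open>Reduces a law on the whole carrier to codes \<open>e (x, b)\<close>, on which the
  simplification rules compute and \<open>the_inv e\<close> disappears.\<close>

lemma ball_semidirect:
  "(\<forall>c \<in> carrier (semidirect e T). Q c) \<longleftrightarrow>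
     (\<forall>x \<in> carrier (act_X T). \<forall>b \<in> carrier (act_B T). Q (e (x, b)))"
  by (auto simp: semidirect_def)

lemma ball_pos_semidirect:
  "(\<forall>c \<in> pos (semidirect e T). Q c) \<longleftrightarrow>
     (\<forall>u \<in> carrier (act_X T). \<forall>v \<in> pos (act_B T). act_xi T (u, v) = u \<longrightarrow> Q (e (u, v)))"
  by (auto simp: semidirect_def)

lemma ext_of_maps [simp]:
  "x \<in> carrier (act_X T) \<Longrightarrow> ext_k (ext_of e T) x = e (x, \<one>\<^bsub>act_B T\<^esub>)"
  "b \<in> carrier (act_B T) \<Longrightarrow> ext_s (ext_of e T) b = e (\<one>\<^bsub>act_X T\<^esub>, b)"
  "x \<in> carrier (act_X T) \<Longrightarrow> b \<in> carrier (act_B T) \<Longrightarrow> ext_p (ext_of e T) (e (x, b)) = b"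
  "x \<in> carrier (act_X T) \<Longrightarrow> b \<in> carrier (act_B T) \<Longrightarrow> ext_q (ext_of e T) (e (x, b)) = x"
  by (simp_all add: ext_of_def)

lemma ext_of_extensional:
  "ext_k (ext_of e T) \<in> extensional (carrier (act_X T))"
  "ext_s (ext_of e T) \<in> extensional (carrier (act_B T))"
  "ext_p (ext_of e T) \<in> extensional (carrier (semidirect e T))"
  "ext_q (ext_of e T) \<in> extensional (carrier (semidirect e T))"
  by (simp_all add: ext_of_def)

lemma funcset_semidirect:
  "f \<in> carrier (semidirect e T) \<rightarrow> S \<longleftrightarrow>
     (\<forall>x \<in> carrier (act_X T). \<forall>b \<in> carrier (act_B T). f (e (x, b)) \<in> S)"
  by (auto simp: semidirect_def)

end

section \<open>The semidirect product as a Schreier split extension\<close>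

locale coded_preordered_action = pairing e + preordered_action T
  for e :: "'u \<times> 'u \<Rightarrow> 'u" and T :: "'u preord_action"
begin

text \<open>The monoid laws follow from those of \<open>X\<close> and \<open>B\<close> together with
  the action laws for \<open>\<phi>\<close>. For the positive codes, (A2) at \<open>\<one>\<close>
  gives the unit, (A3) closure and (A4) right normality.\<close>

lemma is_rn_monoid_semidirect: "is_rn_monoid (semidirect e T)"
  unfolding is_rn_monoid_def
proof
  have "\<forall>c \<in> carrier (semidirect e T). \<forall>d \<in> carrier (semidirect e T).
      c \<otimes>\<^bsub>semidirect e T\<^esub> d \<in> carrier (semidirect e T)"
    by (simp add: ball_semidirect)
  moreover have "\<forall>c \<in> carrier (semidirect e T). \<forall>d \<in> carrier (semidirect e T).
      \<forall>g \<in> carrier (semidirect e T).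
      c \<otimes>\<^bsub>semidirect e T\<^esub> d \<otimes>\<^bsub>semidirect e T\<^esub> g = c \<otimes>\<^bsub>semidirect e T\<^esub> (d \<otimes>\<^bsub>semidirect e T\<^esub> g)"
    by (simp add: ball_semidirect X.m_assoc B.m_assoc phi_mult_left phi_mult_right)
  moreover have "\<forall>c \<in> carrier (semidirect e T). \<one>\<^bsub>semidirect e T\<^esub> \<otimes>\<^bsub>semidirect e T\<^esub> c = c"
    "\<forall>c \<in> carrier (semidirect e T). c \<otimes>\<^bsub>semidirect e T\<^esub> \<one>\<^bsub>semidirect e T\<^esub> = c"
    by (simp_all add: ball_semidirect one_semidirect phi_one_left phi_one_right)
  ultimately show "monoid (semidirect e T)"
    by unfold_locales (auto simp: one_semidirect)
  have "pos (semidirect e T) \<subseteq> carrier (semidirect e T)"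
    by (auto simp: semidirect_def pos_closed)
  moreover have "\<forall>c \<in> pos (semidirect e T). \<forall>d \<in> pos (semidirect e T).
      c \<otimes>\<^bsub>semidirect e T\<^esub> d \<in> pos (semidirect e T)"
    by (simp add: ball_pos_semidirect A3 pos_mult pos_closed)
  moreover have "\<forall>a \<in> carrier (semidirect e T). \<forall>c \<in> pos (semidirect e T).
      \<exists>d \<in> pos (semidirect e T). a \<otimes>\<^bsub>semidirect e T\<^esub> c = d \<otimes>\<^bsub>semidirect e T\<^esub> a"
    unfolding ball_semidirect ball_pos_semidirect
  proof (intro ballI impI)
    fix x b u v
    assume "x \<in> carrier X" "b \<in> carrier B" "u \<in> carrier X" "v \<in> pos B" "\<xi> (u, v) = u"
    then obtain u' v' where "u' \<in> carrier X" "v' \<in> pos B" "b \<otimes>\<^bsub>B\<^esub> v = v' \<otimes>\<^bsub>B\<^esub> b"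
      "x \<otimes>\<^bsub>X\<^esub> \<phi> b u = u' \<otimes>\<^bsub>X\<^esub> \<phi> v' x" "\<xi> (u', v') = u'"
      using A4[of x u v b] by blast
    then show "\<exists>d \<in> pos (semidirect e T).
        e (x, b) \<otimes>\<^bsub>semidirect e T\<^esub> e (u, v) = d \<otimes>\<^bsub>semidirect e T\<^esub> e (x, b)"
      by (intro bexI[of _ "e (u', v')"]) auto
  qed
  ultimately show "right_normal (pos (semidirect e T)) (semidirect e T)"
    by (simp add: right_normal_iff one_semidirect A2 pos_one)
qed

text \<open>(A2) says that \<open>k\<close> is monotone and (A1) that \<open>s\<close> is;
  \<open>p\<close> is monotone since a positive pair has its second component in
  \<open>pos B\<close>. Conditions (S1) and (S2) come from
  \<open>(x, 0) + (0, b) = (x, b)\<close>.\<close>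

lemma is_split_ext_ext_of: "is_split_ext (ext_of e T)"
proof -
  have "ext_k (ext_of e T) \<in> rn_hom X (semidirect e T)"
    by (simp add: rn_hom_iff PiE_def Pi_def ext_of_extensional one_semidirect phi_one_left
        pos_closed pos_one A2)
  moreover have "ext_s (ext_of e T) \<in> rn_hom B (semidirect e T)"
    by (simp add: rn_hom_iff PiE_def Pi_def ext_of_extensional one_semidirect phi_one_right
        pos_closed A1)
  moreover have "ext_p (ext_of e T) \<in> rn_hom (semidirect e T) B"
    by (simp add: rn_hom_iff PiE_def funcset_semidirect ext_of_extensional one_semidirect
        ball_semidirect ball_pos_semidirect pos_closed)
  moreover have "ext_q (ext_of e T) \<in> carrier (semidirect e T) \<rightarrow>\<^sub>E carrier X"
    by (simp add: PiE_def funcset_semidirect ext_of_extensional)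
  moreover have "bij_betw (ext_k (ext_of e T)) (carrier X)
      (kernel (semidirect e T) B (ext_p (ext_of e T)))"
  proof (rule bij_betw_imageI)
    show "inj_on (ext_k (ext_of e T)) (carrier X)"
      by (auto intro: inj_onI)
    show "ext_k (ext_of e T) ` carrier X = kernel (semidirect e T) B (ext_p (ext_of e T))"
      (is "_ = ?K")
    proof
      show "ext_k (ext_of e T) ` carrier X \<subseteq> ?K" by (auto simp: kernel_def)
      have "\<forall>c \<in> carrier (semidirect e T).
          ext_p (ext_of e T) c = \<one>\<^bsub>B\<^esub> \<longrightarrow> c \<in> ext_k (ext_of e T) ` carrier X"
        by (simp add: ball_semidirect)
      then show "?K \<subseteq> ext_k (ext_of e T) ` carrier X" by (auto simp: kernel_def)
    qed
  qed
  ultimately show ?thesis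
    using X_rn B_rn is_rn_monoid_semidirect
    by (simp add: is_split_ext_def Let_def ball_semidirect phi_one_left phi_one_right)
qed

end

section \<open>The functor from actions to split extensions\<close>

context pairing
begin

text \<open>Equivariance makes the middle map multiplicative, and preservation of the fixed points
  of \<open>\<xi>\<close> makes it monotone.\<close>

lemma ext_functor_hom:
  assumes "is_preord_action T" "is_preord_action T'" "(f0, f2) \<in> preord_action_hom T T'"
  shows "(f0, \<lambda>c \<in> carrier (semidirect e T). case the_inv e c of (x, b) \<Rightarrow> e (f0 x, f2 b), f2)
    \<in> split_ext_hom (ext_of e T) (ext_of e T')"
proof -
  interpret T: coded_preordered_action e T using assms by unfold_locales
  interpret T': coded_preordered_action e T' using assms by unfold_locales
  have f: "f0 \<in> rn_hom T.X T'.X" "f2 \<in> rn_hom T.B T'.B"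
    and "\<And>b x. b \<in> carrier T.B \<Longrightarrow> x \<in> carrier T.X \<Longrightarrow> f0 (T.\<phi> b x) = T'.\<phi> (f2 b) (f0 x)"
    and "\<And>u v. u \<in> carrier T.X \<Longrightarrow> v \<in> pos T.B \<Longrightarrow> T.\<xi> (u, v) = u \<Longrightarrow> T'.\<xi> (f0 u, f2 v) = f0 u"
    using assms(3) by (auto simp: preord_action_hom_iff)
  note [simp] = this(3,4) f[THEN rn_hom_closed] f[THEN rn_hom_mult] f[THEN rn_hom_pos]
    f[THEN rn_hom_one]
  show ?thesis
    \<comment> \<open>The first call settles the commuting conditions; the second shows that the
      middle map belongs to \<open>rn_hom\<close>.\<close>
    by (simp add: split_ext_hom_iff f ball_semidirect)
      (simp add: rn_hom_iff PiE_def funcset_semidirect ball_semidirect ball_pos_semidirect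
        one_semidirect T.pos_closed)
qed

text \<open>Checked on codes. The hypotheses on \<open>f0\<close> and \<open>f2\<close> keep the
  intermediate code in the carrier of the second semidirect product, where the restricted map takes
  its intended value.\<close>

lemma ext_functor_compose:
  assumes f: "f0 \<in> rn_hom (act_X T) (act_X T')" "f2 \<in> rn_hom (act_B T) (act_B T')"
  shows "(\<lambda>c \<in> carrier (semidirect e T). case the_inv e c of (x, b) \<Rightarrow>
      e (compose (carrier (act_X T)) g0 f0 x, compose (carrier (act_B T)) g2 f2 b)) =
    compose (carrier (semidirect e T))
      (\<lambda>c \<in> carrier (semidirect e T'). case the_inv e c of (x, b) \<Rightarrow> e (g0 x, g2 b))
      (\<lambda>c \<in> carrier (semidirect e T). case the_inv e c of (x, b) \<Rightarrow> e (f0 x, f2 b))"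
  (is "?l = ?r")
proof (rule extensionalityI)
  show "?l \<in> extensional (carrier (semidirect e T))" by simp
  show "?r \<in> extensional (carrier (semidirect e T))" by simp
  have "\<forall>c \<in> carrier (semidirect e T). ?l c = ?r c"
    by (simp add: ball_semidirect compose_eq f[THEN rn_hom_closed])
  then show "?l c = ?r c" if "c \<in> carrier (semidirect e T)" for c using that by blast
qed

lemma cat_functor_ext_functor:
  "cat_functor preord_action_cat split_ext_cat (ext_functor e)"
proof
  fix T :: "'u preord_action" assume "T \<in> Obj preord_action_cat"
  then interpret coded_preordered_action e T by unfold_locales simp
  show "on_Obj (ext_functor e) T \<in> Obj split_ext_cat"
    by (simp add: ext_functor_def is_split_ext_ext_of)
next
  fix T T' :: "'u preord_action" and f
  assume "T \<in> Obj preord_action_cat" "T' \<in> Obj preord_action_cat"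
    "f \<in> Hom preord_action_cat T T'"
  then show "on_Hom (ext_functor e) T T' f \<in>
      Hom split_ext_cat (on_Obj (ext_functor e) T) (on_Obj (ext_functor e) T')"
    by (cases f) (simp add: ext_functor_def ext_functor_hom)
next
  fix T :: "'u preord_action" assume "T \<in> Obj preord_action_cat"
  show "on_Hom (ext_functor e) T T (Idn preord_action_cat T) =
      Idn split_ext_cat (on_Obj (ext_functor e) T)"
    by (auto simp: ext_functor_def semidirect_def intro!: restrict_ext)
next
  fix T T' T'' :: "'u preord_action" and f g
  assume "f \<in> Hom preord_action_cat T T'"
  then show "on_Hom (ext_functor e) T T'' (Cmp preord_action_cat T T' T'' g f) =
      Cmp split_ext_cat (on_Obj (ext_functor e) T) (on_Obj (ext_functor e) T')
        (on_Obj (ext_functor e) T'')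
        (on_Hom (ext_functor e) T' T'' g) (on_Hom (ext_functor e) T T' f)"
    by (cases f; cases g)
      (auto simp: ext_functor_def preord_action_hom_iff intro!: ext_functor_compose)
qed

section \<open>The natural isomorphisms\<close>

lemma unit_hom:
  assumes "is_preord_action T"
  shows "Idn preord_action_cat T \<in> preord_action_hom T (action_of (ext_of e T))"
    and "Idn preord_action_cat T \<in> preord_action_hom (action_of (ext_of e T)) T"
proof -
  interpret coded_preordered_action e T using assms by unfold_locales
  interpret E: split_extension "ext_of e T" using is_split_ext_ext_of by unfold_locales
  \<comment> \<open>In the semidirect product \<open>(0, b) + (x, 0) = (b \<cdot> x, b)\<close>,
    whose first projection is \<open>b \<cdot> x\<close>.\<close>
  have phi: "E.act b x = \<phi> b x" if "b \<in> carrier B" "x \<in> carrier X" for b x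
    using that by (simp add: E.act_def)
  \<comment> \<open>Here \<open>k u + s v\<close> is the code of \<open>(u, v)\<close>, which is
    positive exactly when \<open>\<xi>\<close> fixes \<open>u\<close> at \<open>v\<close>.\<close>
  have "act_xi (action_of (ext_of e T)) (u, v) = u \<longleftrightarrow> \<xi> (u, v) = u"
    if "u \<in> carrier X" "v \<in> pos B" for u v
    using that E.xi_action_of[of u v] by (simp add: phi_one_left pos_closed)
  then show "Idn preord_action_cat T \<in> preord_action_hom T (action_of (ext_of e T))"
    "Idn preord_action_cat T \<in> preord_action_hom (action_of (ext_of e T)) T"
    using E.phi_action_of
    by (simp_all add: preord_action_hom_iff rn_hom_id X_rn B_rn pos_closed phi)
qed

text \<open>The same pair of identity maps lies in both hom-sets and is its own inverse. Naturality
  holds because the round trip returns \<open>(f0, f2)\<close> unchanged.\<close>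

lemma natural_iso_unit:
  "is_natural_iso preord_action_cat preord_action_cat id_functor
     (comp_functor action_functor (ext_functor e)) (Idn preord_action_cat)"
  unfolding is_natural_iso_def
proof (intro conjI ballI)
  fix T :: "'u preord_action" assume "T \<in> Obj preord_action_cat"
  then have "is_preord_action T" by simp
  from unit_hom[OF this] show "is_iso preord_action_cat (on_Obj id_functor T)
      (on_Obj (comp_functor action_functor (ext_functor e)) T) (Idn preord_action_cat T)"
    unfolding is_iso_def
    by (auto simp: id_functor_def comp_functor_def action_functor_def ext_functor_def
        compose_restrict_id_right intro!: bexI[of _ "Idn preord_action_cat T"])
next
  fix T T' :: "'u preord_action" and f
  assume "f \<in> Hom preord_action_cat T T'"
  then show "Cmp preord_action_cat (on_Obj id_functor T) (on_Obj id_functor T')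
      (on_Obj (comp_functor action_functor (ext_functor e)) T') (Idn preord_action_cat T')
      (on_Hom id_functor T T' f) =
    Cmp preord_action_cat (on_Obj id_functor T)
      (on_Obj (comp_functor action_functor (ext_functor e)) T)
      (on_Obj (comp_functor action_functor (ext_functor e)) T')
      (on_Hom (comp_functor action_functor (ext_functor e)) T T' f) (Idn preord_action_cat T)"
    by (cases f)
      (auto simp: id_functor_def comp_functor_def action_functor_def ext_functor_def
        preord_action_hom_iff compose_restrict_id_right compose_restrict_id_left
        rn_hom_extensional rn_hom_closed)
qed

section \<open>The counit and its inverse\<close>

definition decompose :: "'u split_ext \<Rightarrow> 'u \<Rightarrow> 'u" where
  "decompose E = (\<lambda>a \<in> carrier (ext_A E). e (ext_q E a, ext_p E a))"

definition recompose :: "'u split_ext \<Rightarrow> 'u \<Rightarrow> 'u" where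
  "recompose E = (\<lambda>c \<in> carrier (semidirect e (action_of E)).
     case the_inv e c of (x, b) \<Rightarrow> ext_k E x \<otimes>\<^bsub>ext_A E\<^esub> ext_s E b)"

definition counit :: "'u split_ext \<Rightarrow> ('u \<Rightarrow> 'u) \<times> ('u \<Rightarrow> 'u) \<times> ('u \<Rightarrow> 'u)" where
  "counit E = (\<lambda>x \<in> carrier (ext_X E). x, recompose E, \<lambda>b \<in> carrier (ext_B E). b)"

definition counit_inv :: "'u split_ext \<Rightarrow> ('u \<Rightarrow> 'u) \<times> ('u \<Rightarrow> 'u) \<times> ('u \<Rightarrow> 'u)" where
  "counit_inv E = (\<lambda>x \<in> carrier (ext_X E). x, decompose E, \<lambda>b \<in> carrier (ext_B E). b)"

lemma recompose_e [simp]: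
  "x \<in> carrier (ext_X E) \<Longrightarrow> b \<in> carrier (ext_B E) \<Longrightarrow>
     recompose E (e (x, b)) = ext_k E x \<otimes>\<^bsub>ext_A E\<^esub> ext_s E b"
  by (simp add: recompose_def)

end

locale coded_split_extension = pairing e + split_extension E
  for e :: "'u \<times> 'u \<Rightarrow> 'u" and E :: "'u split_ext"
begin

lemma decompose_k_s:
  "x \<in> carrier X \<Longrightarrow> b \<in> carrier B \<Longrightarrow> decompose E (k x \<otimes>\<^bsub>A\<^esub> s b) = e (x, b)"
  by (simp add: decompose_def S2 p_k_s)

text \<open>Multiplicativity is \<open>k_s_mult\<close>; monotonicity is the description of the
  fixed points of \<open>\<xi>\<close> in \<open>xi_action_of\<close>.\<close>

lemma recompose_hom: "recompose E \<in> rn_hom (semidirect e (action_of E)) A"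
  by (simp add: rn_hom_iff PiE_def funcset_semidirect ball_semidirect ball_pos_semidirect
      one_semidirect k_s_mult rn_hom_one[OF k_hom] rn_hom_one[OF s_hom] xi_action_of pos_closed)
    (simp add: recompose_def)

lemma counit_hom: "counit E \<in> split_ext_hom (ext_of e (action_of E)) E"
  by (simp add: counit_def split_ext_hom_iff rn_hom_id X_rn B_rn recompose_hom ball_semidirect
      rn_hom_one[OF k_hom] rn_hom_one[OF s_hom] p_k_s S2)

text \<open>Writing both factors as in (S1) reduces multiplicativity to \<open>k_s_mult\<close>. For
  positive \<open>a\<close> the sum \<open>k (q a) + s (p a) = a\<close> is positive, so
  \<open>\<xi>\<close> fixes \<open>q a\<close> at \<open>p a\<close> and the code is positive,
  although \<open>q a\<close> itself may fail to be in \<open>pos X\<close>.\<close>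

lemma decompose_hom: "decompose E \<in> rn_hom A (semidirect e (action_of E))"
proof -
  have "decompose E (a \<otimes>\<^bsub>A\<^esub> a') = decompose E a \<otimes>\<^bsub>semidirect e (action_of E)\<^esub> decompose E a'"
    if "a \<in> carrier A" "a' \<in> carrier A" for a a'
  proof -
    have "a \<otimes>\<^bsub>A\<^esub> a' = k (q a \<otimes>\<^bsub>X\<^esub> act (p a) (q a')) \<otimes>\<^bsub>A\<^esub> s (p a \<otimes>\<^bsub>B\<^esub> p a')"
      using k_s_mult[of "q a" "p a" "q a'" "p a'"] that by (simp add: S1)
    then have "decompose E (a \<otimes>\<^bsub>A\<^esub> a') = e (q a \<otimes>\<^bsub>X\<^esub> act (p a) (q a'), p a \<otimes>\<^bsub>B\<^esub> p a')"
      using that by (simp add: decompose_k_s)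
    then show ?thesis
      using that by (simp add: decompose_def)
  qed
  moreover have "decompose E \<one>\<^bsub>A\<^esub> = \<one>\<^bsub>semidirect e (action_of E)\<^esub>"
    using decompose_k_s[of "\<one>\<^bsub>X\<^esub>" "\<one>\<^bsub>B\<^esub>"]
    by (simp add: rn_hom_one[OF k_hom] rn_hom_one[OF s_hom] one_semidirect)
  ultimately show ?thesis
    by (simp add: rn_hom_iff)
      (simp add: decompose_def PiE_def Pi_def xi_action_of S1 pos_closed rn_hom_pos[OF p_hom])
qed

lemma counit_inv_hom: "counit_inv E \<in> split_ext_hom E (ext_of e (action_of E))"
  by (simp add: counit_inv_def split_ext_hom_iff rn_hom_id X_rn B_rn decompose_hom)
    (simp add: decompose_def q_k q_s p_s)

text \<open>One composite of the middle maps is the identity by (S1), the other by uniqueness of the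
  components of a normal form.\<close>

lemma is_iso_counit: "is_iso split_ext_cat (ext_of e (action_of E)) E (counit E)"
proof -
  have "compose (carrier A) (recompose E) (decompose E) = (\<lambda>a \<in> carrier A. a)"
    by (auto simp: compose_def decompose_def S1 intro!: restrict_ext)
  moreover have "compose (carrier (semidirect e (action_of E))) (decompose E) (recompose E) =
      (\<lambda>c \<in> carrier (semidirect e (action_of E)). c)"
  proof -
    have "\<forall>c \<in> carrier (semidirect e (action_of E)). decompose E (recompose E c) = c"
      by (simp add: ball_semidirect decompose_k_s)
    then show ?thesis by (auto simp: compose_def intro!: restrict_ext)
  qed
  ultimately have
    "Cmp split_ext_cat (ext_of e (action_of E)) E (ext_of e (action_of E)) (counit_inv E) (counit E)
      = Idn split_ext_cat (ext_of e (action_of E))"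
    "Cmp split_ext_cat E (ext_of e (action_of E)) E (counit E) (counit_inv E) = Idn split_ext_cat E"
    by (simp_all add: counit_def counit_inv_def compose_restrict_id_right)
  then show ?thesis
    using counit_hom counit_inv_hom by (auto simp: is_iso_def)
qed

end

context pairing
begin

text \<open>On the code of \<open>(x, b)\<close> this reads
  \<open>k' (f0 x) + s' (f2 b) = f1 (k x + s b)\<close>, which holds because \<open>f1\<close> is a
  homomorphism commuting with \<open>k\<close> and \<open>s\<close>.\<close>

lemma recompose_natural:
  assumes "is_split_ext E" "(f0, f1, f2) \<in> split_ext_hom E E'"
  shows "compose (carrier (semidirect e (action_of E))) (recompose E')
      (\<lambda>c \<in> carrier (semidirect e (action_of E)). case the_inv e c of (x, b) \<Rightarrow> e (f0 x, f2 b)) =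
    compose (carrier (semidirect e (action_of E))) f1 (recompose E)"
  (is "?l = ?r")
proof (rule extensionalityI)
  interpret E: split_extension E using assms by unfold_locales
  have f: "f0 \<in> rn_hom (ext_X E) (ext_X E')" "f1 \<in> rn_hom (ext_A E) (ext_A E')"
      "f2 \<in> rn_hom (ext_B E) (ext_B E')"
    using assms(2) by (simp_all add: split_ext_hom_iff)
  show "?l \<in> extensional (carrier (semidirect e (action_of E)))" by simp
  show "?r \<in> extensional (carrier (semidirect e (action_of E)))" by simp
  have "\<forall>c \<in> carrier (semidirect e (action_of E)). ?l c = ?r c"
    using assms(2) by (simp add: ball_semidirect compose_eq f[THEN rn_hom_closed]
        rn_hom_mult[OF f(2)] split_ext_hom_iff)
  then show "?l c = ?r c" if "c \<in> carrier (semidirect e (action_of E))" for c using that by blast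
qed

text \<open>The outer components of \<open>counit\<close> are identities, so the content of
  naturality lies in the middle component.\<close>

lemma natural_iso_counit:
  "is_natural_iso split_ext_cat split_ext_cat
     (comp_functor (ext_functor e) action_functor) id_functor counit"
  unfolding is_natural_iso_def
proof (intro conjI ballI)
  fix E :: "'u split_ext" assume "E \<in> Obj split_ext_cat"
  then interpret coded_split_extension e E by unfold_locales simp
  show "is_iso split_ext_cat (on_Obj (comp_functor (ext_functor e) action_functor) E)
      (on_Obj id_functor E) (counit E)"
    using is_iso_counit
    by (simp add: id_functor_def comp_functor_def action_functor_def ext_functor_def)
next
  fix E E' :: "'u split_ext" and f
  assume "E \<in> Obj split_ext_cat" "E' \<in> Obj split_ext_cat" "f \<in> Hom split_ext_cat E E'"
  moreover obtain f0 f1 f2 where "f = (f0, f1, f2)" by (cases f)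
  ultimately show
    "Cmp split_ext_cat (on_Obj (comp_functor (ext_functor e) action_functor) E)
       (on_Obj (comp_functor (ext_functor e) action_functor) E') (on_Obj id_functor E') (counit E')
       (on_Hom (comp_functor (ext_functor e) action_functor) E E' f) =
     Cmp split_ext_cat (on_Obj (comp_functor (ext_functor e) action_functor) E)
       (on_Obj id_functor E) (on_Obj id_functor E') (on_Hom id_functor E E' f) (counit E)"
    using recompose_natural[of E f0 f1 f2 E']
    by (auto simp: id_functor_def comp_functor_def action_functor_def ext_functor_def counit_def
        split_ext_hom_iff compose_restrict_id_right compose_restrict_id_left
        rn_hom_extensional rn_hom_closed)
qed

end

section \<open>Coding pairs in an infinite universe, and the equivalence\<close>

text \<open>An infinite set is equinumerous with its square. This is how the infinite type
  \<open>'u\<close> becomes closed under the semidirect products that the construction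
  needs.\<close>

lemma ex_inj_pairing:
  assumes "infinite (UNIV :: 'u set)"
  shows "\<exists>e :: 'u \<times> 'u \<Rightarrow> 'u. inj e"
proof -
  have "\<exists>e :: 'u \<times> 'u \<Rightarrow> 'u. bij_betw e (UNIV \<times> UNIV) UNIV"
    using card_of_Times_same_infinite[OF assms] by (simp add: card_of_ordIso)
  then show ?thesis by (auto simp: bij_betw_def)
qed

theorem theorem2:
  assumes "infinite (UNIV :: 'u set)"
  shows "equivalent_categories
           (preord_action_cat :: ('u preord_action, ('u \<Rightarrow> 'u) \<times> ('u \<Rightarrow> 'u)) category_data)
           (split_ext_cat :: ('u split_ext, ('u \<Rightarrow> 'u) \<times> ('u \<Rightarrow> 'u) \<times> ('u \<Rightarrow> 'u)) category_data)"
proof -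
  obtain e :: "'u \<times> 'u \<Rightarrow> 'u" where "inj e"
    using ex_inj_pairing[OF assms] by blast
  then interpret pairing e by unfold_locales
  show ?thesis
    unfolding equivalent_categories_def
    using cat_functor_ext_functor cat_functor_action_functor natural_iso_unit natural_iso_counit
    by blast
qed

end
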